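(* (One vs. All.) For every $\varepsilon > 0$ there is a constant $C_\varepsilon$ (depending only on $\varepsilon$) such that for every $n \ge 1$ and every $w \in \{0,1\}^n$ there is a first-order $\tau_{\mathsf{string}}$-sentence, true in $\mathbf{B}_w$ and false in $\mathbf{B}_{w'}$ for every $w' \in \{0,1\}^n\setminus\{w\}$, with at most $(1+\varepsilon)\log(n) + C_\varepsilon$ quantifiers. Moreover, this sentence in prenex form has a quantifier prefix that starts with $\forall$, then has at most $\varepsilon\log(n)+1$ occurrences of $\exists$, and then ends with a strictly alternating quantifier sequence of length at most $\log(n) + C_\varepsilon$.
   Context: $\tau_{\mathsf{string}} = \langle <, S; \mathsf{min}, \mathsf{max}\rangle$ with $<$ binary, $S$ unary, $\mathsf{min},\mathsf{max}$ constants. A string $w = w_1\cdots w_n \in \{0,1\}^n$ is encoded by the structure $\mathbf{B}_w$ with universe $\{1,\dots,n\}$, $<$ the usual order, $S = \{i : w_i = 1\}$, $\mathsf{min}=1$, $\mathsf{max}=n$. The number of quantifiers of a sentence is the number of quantifier occurrences. $\log$ is base 2. *)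

theory Defs
  imports Complex_Main
begin

record 'a string_structure =
  universe :: "'a set"
  less_rel :: "'a \<Rightarrow> 'a \<Rightarrow> bool"
  S_rel :: "'a \<Rightarrow> bool"
  min_const :: 'a
  max_const :: 'a

text \<open>Strings over 0, 1 are boolean lists, with \<open>True\<close> standing for 1. Positions are numbered
  from 1, list indices from 0.\<close>

definition string_struct :: "bool list \<Rightarrow> nat string_structure" where
  "string_struct w =
     \<lparr>universe = {1..length w},
      less_rel = (<),
      S_rel = (\<lambda>i. i \<in> {1..length w} \<and> w ! (i - 1)),
      min_const = 1,
      max_const = length w\<rparr>"

datatype trm = Var nat | MinC | MaxC

datatype fm =
    Less trm trm
  | Eq trm trm
  | InS trm
  | Neg fm
  | Conj fm fm
  | Disj fm fm
  | Exists nat fm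
  | Forall nat fm

primrec trm_val :: "('a, 'b) string_structure_scheme \<Rightarrow> (nat \<Rightarrow> 'a) \<Rightarrow> trm \<Rightarrow> 'a" where
  "trm_val M e (Var x) = e x"
| "trm_val M e MinC = min_const M"
| "trm_val M e MaxC = max_const M"

primrec sat :: "('a, 'b) string_structure_scheme \<Rightarrow> (nat \<Rightarrow> 'a) \<Rightarrow> fm \<Rightarrow> bool" where
  "sat M e (Less s t) \<longleftrightarrow> less_rel M (trm_val M e s) (trm_val M e t)"
| "sat M e (Eq s t) \<longleftrightarrow> trm_val M e s = trm_val M e t"
| "sat M e (InS t) \<longleftrightarrow> S_rel M (trm_val M e t)"
| "sat M e (Neg \<phi>) \<longleftrightarrow> \<not> sat M e \<phi>"
| "sat M e (Conj \<phi> \<psi>) \<longleftrightarrow> sat M e \<phi> \<and> sat M e \<psi>"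
| "sat M e (Disj \<phi> \<psi>) \<longleftrightarrow> sat M e \<phi> \<or> sat M e \<psi>"
| "sat M e (Exists x \<phi>) \<longleftrightarrow> (\<exists>a\<in>universe M. sat M (e(x := a)) \<phi>)"
| "sat M e (Forall x \<phi>) \<longleftrightarrow> (\<forall>a\<in>universe M. sat M (e(x := a)) \<phi>)"

text \<open>For a sentence and a nonempty universe, the choice of the assignment is irrelevant, so
  \<open>\<not> true_in M \<phi>\<close> says that \<open>\<phi>\<close> is false in \<open>M\<close>.\<close>

definition true_in :: "('a, 'b) string_structure_scheme \<Rightarrow> fm \<Rightarrow> bool" where
  "true_in M \<phi> \<longleftrightarrow> (\<forall>e. range e \<subseteq> universe M \<longrightarrow> sat M e \<phi>)"

primrec trm_vars :: "trm \<Rightarrow> nat set" where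
  "trm_vars (Var x) = {x}"
| "trm_vars MinC = {}"
| "trm_vars MaxC = {}"

primrec free_vars :: "fm \<Rightarrow> nat set" where
  "free_vars (Less s t) = trm_vars s \<union> trm_vars t"
| "free_vars (Eq s t) = trm_vars s \<union> trm_vars t"
| "free_vars (InS t) = trm_vars t"
| "free_vars (Neg \<phi>) = free_vars \<phi>"
| "free_vars (Conj \<phi> \<psi>) = free_vars \<phi> \<union> free_vars \<psi>"
| "free_vars (Disj \<phi> \<psi>) = free_vars \<phi> \<union> free_vars \<psi>"
| "free_vars (Exists x \<phi>) = free_vars \<phi> - {x}"
| "free_vars (Forall x \<phi>) = free_vars \<phi> - {x}"

definition sentence :: "fm \<Rightarrow> bool" where
  "sentence \<phi> \<longleftrightarrow> free_vars \<phi> = {}"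

primrec num_quants :: "fm \<Rightarrow> nat" where
  "num_quants (Less s t) = 0"
| "num_quants (Eq s t) = 0"
| "num_quants (InS t) = 0"
| "num_quants (Neg \<phi>) = num_quants \<phi>"
| "num_quants (Conj \<phi> \<psi>) = num_quants \<phi> + num_quants \<psi>"
| "num_quants (Disj \<phi> \<psi>) = num_quants \<phi> + num_quants \<psi>"
| "num_quants (Exists x \<phi>) = Suc (num_quants \<phi>)"
| "num_quants (Forall x \<phi>) = Suc (num_quants \<phi>)"

datatype quant = All_q | Ex_q

text \<open>\<open>prenex qs \<phi>\<close>: the formula \<open>\<phi>\<close> is in prenex form, with quantifier prefix \<open>qs\<close> read from
  the outermost quantifier inwards.\<close>

inductive prenex :: "quant list \<Rightarrow> fm \<Rightarrow> bool" where
  matrix: "num_quants \<phi> = 0 \<Longrightarrow> prenex [] \<phi>"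
| Exists: "prenex qs \<phi> \<Longrightarrow> prenex (Ex_q # qs) (Exists x \<phi>)"
| Forall: "prenex qs \<phi> \<Longrightarrow> prenex (All_q # qs) (Forall x \<phi>)"

end

theory Submission
  imports Defs "HOL-Library.FuncSet" "HOL-Real_Asymp.Real_Asymp"
begin

text \<open>The initial \<open>\<forall>x\<close> picks a position at which \<open>w'\<close> differs from \<open>w\<close>. A block of \<open>2 * m\<close> existential
  quantifiers then spells out a code for the alleged position \<open>i\<close> of \<open>x\<close>, as a word of length \<open>m\<close>
  over \<open>m\<close> marked points; there are \<open>m ^ m \<ge> n\<close> codes already for some \<open>m = o(log n)\<close>. Different
  codes exclude each other, so the sentences for the \<open>n\<close> possible values of \<open>i\<close> can share all later
  quantifiers. These have to check that \<open>x\<close> is position \<open>i\<close>, that is, has distance at least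
  \<open>i - min\<close> to \<open>min\<close> and at least \<open>max - i\<close> to \<open>max\<close>. Every quantifier of an alternating sequence
  halves such distances, since \<open>b - a \<ge> d\<close> holds iff some \<open>u\<close> satisfies
  \<open>u - a \<ge> d\<^sub>1 \<and> b - u \<ge> d\<^sub>2\<close> with \<open>d\<^sub>1 + d\<^sub>2 = d\<close>, and iff all \<open>u\<close> satisfy
  \<open>u - a \<ge> d\<^sub>1 \<or> b - u \<ge> d\<^sub>2\<close> with \<open>d\<^sub>1 + d\<^sub>2 = d + 1\<close>. For the finitely many \<open>n\<close> where \<open>2 * m\<close>
  exceeds \<open>\<epsilon> log n\<close>, the existential block is interleaved with dummy universal quantifiers and
  counted as part of the alternating sequence.\<close>

section \<open>Quantifier prefixes\<close>

primrec quantify :: "(quant \<times> nat) list \<Rightarrow> fm \<Rightarrow> fm" where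
  "quantify [] \<phi> = \<phi>"
| "quantify (p # ps) \<phi> =
     (case fst p of All_q \<Rightarrow> Forall (snd p) (quantify ps \<phi>) | Ex_q \<Rightarrow> Exists (snd p) (quantify ps \<phi>))"

lemma prenex_quantify: "num_quants \<phi> = 0 \<Longrightarrow> prenex (map fst ps) (quantify ps \<phi>)"
  by (induction ps) (auto intro: prenex.intros split: quant.split)

lemma num_quants_quantify: "num_quants (quantify ps \<phi>) = length ps + num_quants \<phi>"
  by (induction ps) (auto split: quant.split)

lemma free_vars_quantify: "free_vars (quantify ps \<phi>) = free_vars \<phi> - snd ` set ps"
  by (induction ps) (auto split: quant.split)

lemma quantify_append: "quantify (ps @ qs) \<phi> = quantify ps (quantify qs \<phi>)"
  by (induction ps) (auto split: quant.split)

text \<open>The matrices are compared only on assignments that keep the values of all variables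
  outside the prefix. Facts about outer variables can thus simplify a matrix below an inner
  prefix.\<close>

lemma sat_quantify_cong:
  assumes "\<And>e'. (\<forall>v. v \<notin> snd ` set ps \<longrightarrow> e' v = e v) \<Longrightarrow> sat M e' \<phi> = sat M e' \<psi>"
  shows "sat M e (quantify ps \<phi>) = sat M e (quantify ps \<psi>)"
  using assms
proof (induction ps arbitrary: e)
  case Nil
  then show ?case by auto
next
  case (Cons p ps)
  have "sat M (e(snd p := a)) (quantify ps \<phi>) = sat M (e(snd p := a)) (quantify ps \<psi>)" for a
    by (rule Cons.IH, rule Cons.prems) auto
  then show ?case by (auto split: quant.split)
qed

lemma sat_quantify_const:
  assumes "universe M \<noteq> {}"
    and "\<And>e'. (\<forall>v. v \<notin> snd ` set ps \<longrightarrow> e' v = e v) \<Longrightarrow> sat M e' \<phi> = b"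
  shows "sat M e (quantify ps \<phi>) = b"
  using assms(2)
proof (induction ps arbitrary: e)
  case Nil
  then show ?case by auto
next
  case (Cons p ps)
  have "sat M (e(snd p := a)) (quantify ps \<phi>) = b" for a
    by (rule Cons.IH, rule Cons.prems) auto
  then show ?case using assms(1) by (auto split: quant.split)
qed

lemma sat_quantify_obtain:
  assumes "universe M \<noteq> {}" and "sat M e (quantify ps \<phi>)"
  obtains e' where "\<forall>v. v \<notin> snd ` set ps \<longrightarrow> e' v = e v" and "sat M e' \<phi>"
proof -
  have "\<not> (\<forall>e'. (\<forall>v. v \<notin> snd ` set ps \<longrightarrow> e' v = e v) \<longrightarrow> \<not> sat M e' \<phi>)"
    using sat_quantify_const[OF assms(1), of ps e \<phi> False] assms(2) by blast
  then show thesis using that by blast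
qed

text \<open>A strategy that ignores the universal moves: every existential variable takes its value
  from \<open>f\<close>. The first hypothesis prevents a later universal quantifier from overwriting
  such a value, while dummy universal variables may repeat.\<close>

lemma sat_quantify_witness:
  assumes "\<And>v. (All_q, v) \<in> set ps \<Longrightarrow> (Ex_q, v) \<notin> set ps"
    and "\<And>v. f v \<in> universe M"
    and "\<And>e'. (\<forall>v. (Ex_q, v) \<in> set ps \<longrightarrow> e' v = f v) \<Longrightarrow>
           (\<forall>v. v \<notin> snd ` set ps \<longrightarrow> e' v = e v) \<Longrightarrow> sat M e' \<phi>"
  shows "sat M e (quantify ps \<phi>)"
  using assms(1,3)
proof (induction ps arbitrary: e)
  case Nil
  then show ?case by auto
next
  case (Cons p ps)
  obtain q v where p: "p = (q, v)" by (cases p)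
  have ih: "sat M (e(v := a)) (quantify ps \<phi>)" if "q = Ex_q \<Longrightarrow> a = f v" for a
  proof (rule Cons.IH)
    show "\<And>v. (All_q, v) \<in> set ps \<Longrightarrow> (Ex_q, v) \<notin> set ps"
      using Cons.prems(1) by auto
    fix e'
    assume e': "\<forall>v. (Ex_q, v) \<in> set ps \<longrightarrow> e' v = f v"
      "\<forall>u. u \<notin> snd ` set ps \<longrightarrow> e' u = (e(v := a)) u"
    show "sat M e' \<phi>"
    proof (rule Cons.prems(2))
      \<comment> \<open>If \<open>v\<close> is bound again in \<open>ps\<close>, that inner
        quantifier is existential too and again assigns \<open>f v\<close>.\<close>
      have "e' v = f v" if "q = Ex_q"
      proof (cases "v \<in> snd ` set ps")
        case True
        then obtain q' where "(q', v) \<in> set ps" by auto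
        moreover have "q' \<noteq> All_q"
          using Cons.prems(1)[of v] calculation p that by auto
        ultimately have "(Ex_q, v) \<in> set ps" by (cases q') auto
        then show ?thesis using e' by auto
      next
        case False
        then show ?thesis using e' \<open>q = Ex_q \<Longrightarrow> a = f v\<close> that by auto
      qed
      then show "\<forall>v. (Ex_q, v) \<in> set (p # ps) \<longrightarrow> e' v = f v"
        using e'(1) p by auto
      show "\<forall>v. v \<notin> snd ` set (p # ps) \<longrightarrow> e' v = e v"
        using e'(2) p by auto
    qed
  qed
  show ?case using ih assms(2) by (cases q) (auto simp: p)
qed

section \<open>Strictly alternating prefixes\<close>

primrec dual_q :: "quant \<Rightarrow> quant" where
  "dual_q All_q = Ex_q"
| "dual_q Ex_q = All_q"

primrec alternating :: "quant \<Rightarrow> nat list \<Rightarrow> (quant \<times> nat) list" where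
  "alternating q [] = []"
| "alternating q (v # vs) = (q, v) # alternating (dual_q q) vs"

lemma length_alternating [simp]: "length (alternating q vs) = length vs"
  by (induction vs arbitrary: q) auto

lemma snd_set_alternating [simp]: "snd ` set (alternating q vs) = set vs"
  by (induction vs arbitrary: q) auto

lemma distinct_adj_alternating: "distinct_adj (map fst (alternating q vs))"
proof (induction vs arbitrary: q)
  case (Cons v vs)
  then show ?case using Cons.IH[of "dual_q q"] by (cases vs; cases q) auto
qed auto

section \<open>Measuring distances by halving\<close>

definition Tt :: fm where
  "Tt = Eq MinC MinC"

text \<open>Half-open, so that \<open>(a, b]\<close> and \<open>(b, c]\<close> are disjoint and one
  quantified point never has to serve both.\<close>

definition Between :: "trm \<Rightarrow> nat \<Rightarrow> trm \<Rightarrow> fm" where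
  "Between a v b = Conj (Less a (Var v)) (Neg (Less b (Var v)))"

definition Imp :: "fm \<Rightarrow> fm \<Rightarrow> fm" where
  "Imp \<phi> \<psi> = Disj (Neg \<phi>) \<psi>"

definition Dist_pos :: "nat \<Rightarrow> trm \<Rightarrow> trm \<Rightarrow> fm" where
  "Dist_pos d a b = (if d = 0 then Tt else Less a b)"

lemma Tt_simps [simp]: "sat M e Tt" "free_vars Tt = {}" "num_quants Tt = 0"
  by (auto simp: Tt_def)

lemma Imp_simps [simp]:
  "sat M e (Imp \<phi> \<psi>) \<longleftrightarrow> (sat M e \<phi> \<longrightarrow> sat M e \<psi>)"
  "free_vars (Imp \<phi> \<psi>) = free_vars \<phi> \<union> free_vars \<psi>"
  "num_quants (Imp \<phi> \<psi>) = num_quants \<phi> + num_quants \<psi>"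
  by (auto simp: Imp_def)

lemma Dist_pos_simps [simp]:
  "sat M e (Dist_pos d a b) \<longleftrightarrow> (d > 0 \<longrightarrow> less_rel M (trm_val M e a) (trm_val M e b))"
  "num_quants (Dist_pos d a b) = 0"
  by (auto simp: Dist_pos_def)

lemma free_vars_Dist_pos: "free_vars (Dist_pos d a b) \<subseteq> trm_vars a \<union> trm_vars b"
  by (auto simp: Dist_pos_def)

lemma Between_simps [simp]:
  "sat M e (Between a v b) \<longleftrightarrow> less_rel M (trm_val M e a) (e v) \<and> \<not> less_rel M (trm_val M e b) (e v)"
  "free_vars (Between a v b) = trm_vars a \<union> trm_vars b \<union> {v}"
  "num_quants (Between a v b) = 0"
  by (auto simp: Between_def)

text \<open>Under alternating prefixes over the variables below \<open>k\<close>, starting with \<open>\<forall>\<close> and with \<open>\<exists>\<close>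
  respectively, these matrices express \<open>b - a \<ge> d \<and> c - b \<ge> d'\<close> and \<open>b - a \<ge> d \<or> c - b \<ge> d'\<close>.
  A single quantifier halves both intervals: it picks a point of either \<open>(a, b]\<close> or \<open>(b, c]\<close>,
  and the position of that point tells which of the two intervals is refined.\<close>

fun both_ge either_ge :: "nat \<Rightarrow> trm \<Rightarrow> trm \<Rightarrow> trm \<Rightarrow> nat \<Rightarrow> nat \<Rightarrow> fm" where
  "both_ge 0 a b c d d' = Conj (Dist_pos d a b) (Dist_pos d' b c)"
| "both_ge (Suc k) a b c d d' =
     Conj (Conj (Dist_pos d a b) (Dist_pos d' b c))
       (Conj (Imp (Between a k b) (either_ge k a (Var k) b (d div 2 + 1) ((d + 1) div 2)))
             (Imp (Between b k c) (either_ge k b (Var k) c (d' div 2 + 1) ((d' + 1) div 2))))"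
| "either_ge 0 a b c d d' = Disj (Dist_pos d a b) (Dist_pos d' b c)"
| "either_ge (Suc k) a b c d d' =
     (if d = 0 \<or> d' = 0 then Tt else
      Disj (Conj (Between a k b) (both_ge k a (Var k) b ((d + 1) div 2) (d div 2)))
           (Conj (Between b k c) (both_ge k b (Var k) c ((d' + 1) div 2) (d' div 2))))"

lemma num_quants_ge [simp]:
  "num_quants (both_ge k a b c d d') = 0" "num_quants (either_ge k a b c d d') = 0"
  by (induction k a b c d d' and k a b c d d' rule: both_ge_either_ge.induct) auto

lemma free_vars_ge:
  "free_vars (both_ge k a b c d d') \<subseteq> trm_vars a \<union> trm_vars b \<union> trm_vars c \<union> {..<k}"
  "free_vars (either_ge k a b c d d') \<subseteq> trm_vars a \<union> trm_vars b \<union> trm_vars c \<union> {..<k}"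
proof (induction k a b c d d' and k a b c d d' rule: both_ge_either_ge.induct)
  case (1 a b c d d')
  then show ?case using free_vars_Dist_pos[of d a b] free_vars_Dist_pos[of d' b c] by auto
next
  case (2 k a b c d d')
  have "{..<k} \<subseteq> {..<Suc k}" by auto
  with 2 show ?case using free_vars_Dist_pos[of d a b] free_vars_Dist_pos[of d' b c]
    by (simp add: lessThan_Suc) blast
next
  case (3 a b c d d')
  then show ?case using free_vars_Dist_pos[of d a b] free_vars_Dist_pos[of d' b c] by auto
next
  case (4 k a b c d d')
  then show ?case by (simp add: lessThan_Suc) blast
qed

text \<open>A point \<open>u\<close> defeats both alternatives iff it is at most
  \<open>d div 2\<close> above \<open>a\<close> and less than \<open>(d + 1) div 2\<close> below
  \<open>b\<close>, which forces \<open>b - a < d\<close>. The guard covers \<open>a = b\<close>,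
  where no \<open>u\<close> exists.\<close>

lemma split_all:
  fixes a b d :: nat
  assumes "a \<le> b"
  shows "d \<le> b - a \<longleftrightarrow> (d > 0 \<longrightarrow> a < b) \<and>
    (\<forall>u. a < u \<and> u \<le> b \<longrightarrow> d div 2 + 1 \<le> u - a \<or> (d + 1) div 2 \<le> b - u)"
proof -
  define p q where "p = d div 2" and "q = (d + 1) div 2"
  have pq: "p + q = d" "p \<le> q" "q \<le> p + 1" by (auto simp: p_def q_def)
  have "d \<le> b - a" if r: "d > 0 \<longrightarrow> a < b"
    "\<forall>u. a < u \<and> u \<le> b \<longrightarrow> p + 1 \<le> u - a \<or> q \<le> b - u"
  proof (cases "p = 0")
    case True
    then show ?thesis using r pq by (cases "d = 0") auto
  next
    case False
    show ?thesis
    proof (rule ccontr)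
      assume "\<not> d \<le> b - a"
      \<comment> \<open>The defeating point is \<open>a + p\<close>, capped at \<open>b\<close>;
        \<open>p > 0\<close> and \<open>a < b\<close> keep it in \<open>(a, b]\<close>.\<close>
      with False r pq assms have "a < min (a + p) b" "\<not> p + 1 \<le> min (a + p) b - a"
        "\<not> q \<le> b - min (a + p) b"
        by (auto simp: min_def)
      moreover have "min (a + p) b \<le> b" by simp
      ultimately show False using r(2) by blast
    qed
  qed
  moreover have "p + 1 \<le> u - a \<or> q \<le> b - u" if "d \<le> b - a" for u
    using that pq(1) by linarith
  moreover have "d > 0 \<longrightarrow> a < b" if "d \<le> b - a"
    using that by linarith
  ultimately show ?thesis unfolding p_def[symmetric] q_def[symmetric] by blast
qed

lemma split_ex:
  fixes a b d :: nat
  assumes "a \<le> b" "d > 0"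
  shows "d \<le> b - a \<longleftrightarrow>
    (\<exists>u. a < u \<and> u \<le> b \<and> (d + 1) div 2 \<le> u - a \<and> d div 2 \<le> b - u)"
proof -
  define p q where "p = d div 2" and "q = (d + 1) div 2"
  have pq: "p + q = d" "q > 0" using assms by (auto simp: p_def q_def)
  \<comment> \<open>The witness lies \<open>q\<close> above \<open>a\<close>, and
    \<open>q > 0\<close> puts it inside the half-open interval.\<close>
  have "a < a + q \<and> a + q \<le> b \<and> q \<le> a + q - a \<and> p \<le> b - (a + q)" if "d \<le> b - a"
    using that pq assms by auto
  moreover have "d \<le> b - a" if "a < u" "u \<le> b" "q \<le> u - a" "p \<le> b - u" for u
    using that pq by linarith
  ultimately show ?thesis unfolding p_def[symmetric] q_def[symmetric] by blast
qed

lemma trm_val_agree: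
  assumes "trm_vars t \<subseteq> {k..}" "\<forall>v. v \<notin> {..<k} \<longrightarrow> e' v = e v"
  shows "trm_val M e' t = trm_val M e t"
  using assms by (cases t) auto

lemma power_2_mod_3: "(2::nat) ^ k mod 3 = (if even k then 1 else 2)"
proof (induction k)
  case (Suc k)
  have "(2::nat) ^ Suc k mod 3 = 2 * (2 ^ k mod 3) mod 3" by (simp add: mod_simps)
  then show ?case using Suc by auto
qed auto

text \<open>With \<open>p = 2 ^ k\<close>, the bounds on measurable distances for
  \<open>k = 0, 1, 2, ...\<close> are 1, 2, 3, 6, 11, ...: an \<exists> doubles the bound, a
  \<forall> doubles it and loses 1. The residues modulo 3 make the closed forms, about two thirds of
  \<open>2 ^ k\<close>, exact.\<close>

lemma halving_bounds:
  fixes p d :: nat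
  shows "p mod 3 = 2 \<Longrightarrow> 3 * d \<le> 2 * (2 * p) + 1 \<Longrightarrow> 3 * (d div 2 + 1) \<le> 2 * p + 2 \<and> 3 * ((d + 1) div 2) \<le> 2 * p + 2"
    and "p mod 3 = 1 \<Longrightarrow> 3 * d \<le> 2 * (2 * p) + 2 \<Longrightarrow> 3 * ((d + 1) div 2) \<le> 2 * p + 1 \<and> 3 * (d div 2) \<le> 2 * p + 1"
proof -
  define t x y where "t = p div 3" and x_def: "x = d div 2" and y_def: "y = (d + 1) div 2"
  have xy: "x + y = d" "x \<le> y" "y \<le> x + 1" by (auto simp: x_def y_def)
  show "3 * (d div 2 + 1) \<le> 2 * p + 2 \<and> 3 * ((d + 1) div 2) \<le> 2 * p + 2"
    if "p mod 3 = 2" "3 * d \<le> 2 * (2 * p) + 1"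
  proof -
    have p: "p = 3 * t + 2" using that(1) mod_mult_div_eq[of p 3] by (simp add: t_def)
    then have "d \<le> 4 * t + 3" using that(2) by simp
    then have "x \<le> 2 * t + 1" "y \<le> 2 * t + 2" using xy by linarith+
    moreover have "2 * p + 2 = 3 * (2 * t + 2)" by (simp add: p)
    ultimately show ?thesis by (simp only: x_def[symmetric] y_def[symmetric]) simp
  qed
  show "3 * ((d + 1) div 2) \<le> 2 * p + 1 \<and> 3 * (d div 2) \<le> 2 * p + 1"
    if "p mod 3 = 1" "3 * d \<le> 2 * (2 * p) + 2"
  proof -
    have p: "p = 3 * t + 1" using that(1) mod_mult_div_eq[of p 3] by (simp add: t_def)
    then have "d \<le> 4 * t + 2" using that(2) by simp
    then have "x \<le> 2 * t + 1" "y \<le> 2 * t + 1" using xy by linarith+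
    moreover have "2 * p + 1 = 3 * (2 * t + 1)" by (simp add: p)
    ultimately show ?thesis by (simp only: x_def[symmetric] y_def[symmetric]) simp
  qed
qed

text \<open>The bounds on \<open>d\<close> and \<open>d'\<close> are those of the halving recursion with \<open>\<exists>\<close> as the innermost
  quantifier. They fail for the other parity of \<open>k\<close>.\<close>

lemma sat_ge:
  fixes w d d'
  defines "M \<equiv> string_struct w"
  assumes "trm_vars a \<subseteq> {k..}" "trm_vars b \<subseteq> {k..}" "trm_vars c \<subseteq> {k..}"
    and "trm_val M e a \<le> trm_val M e b" "trm_val M e b \<le> trm_val M e c"
    and "trm_val M e a \<in> universe M" "trm_val M e c \<in> universe M"
  shows "(even k \<longrightarrow> 3 * d \<le> 2 * 2 ^ k + 1 \<longrightarrow> 3 * d' \<le> 2 * 2 ^ k + 1 \<longrightarrow>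
      (sat M e (quantify (alternating All_q (rev [0..<k])) (both_ge k a b c d d')) \<longleftrightarrow>
      d \<le> trm_val M e b - trm_val M e a \<and> d' \<le> trm_val M e c - trm_val M e b)) \<and>
    (odd k \<longrightarrow> 3 * d \<le> 2 * 2 ^ k + 2 \<longrightarrow> 3 * d' \<le> 2 * 2 ^ k + 2 \<longrightarrow>
      (sat M e (quantify (alternating Ex_q (rev [0..<k])) (either_ge k a b c d d')) \<longleftrightarrow>
      d \<le> trm_val M e b - trm_val M e a \<or> d' \<le> trm_val M e c - trm_val M e b))"
  using assms(2-)
proof (induction k arbitrary: e a b c d d')
  case 0
  have "less_rel M = (<)" by (simp add: M_def string_struct_def)
  moreover have "x \<le> v - u \<longleftrightarrow> (0 < x \<longrightarrow> u < v)" if "3 * x \<le> 2 * 2 ^ 0 + 1" for x u v :: nat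
  proof -
    have "x \<le> 1" using that by simp
    then show ?thesis by (cases "x = 0") auto
  qed
  ultimately show ?case by simp
next
  case (Suc k)
  define A B C where ABC: "A = trm_val M e a" "B = trm_val M e b" "C = trm_val M e c"
  have le: "A \<le> B" "B \<le> C" using Suc.prems by (auto simp: ABC)
  have lt [simp]: "less_rel M = (<)" by (simp add: M_def string_struct_def)
  have univ: "universe M = {1..length w}" by (simp add: M_def string_struct_def)
  have ends: "A \<in> universe M" "C \<in> universe M" using Suc.prems by (auto simp: ABC)
  have inside: "A < u \<Longrightarrow> u \<le> B \<Longrightarrow> u \<in> universe M" "B < u \<Longrightarrow> u \<le> C \<Longrightarrow> u \<in> universe M" for u
    using ends le by (simp_all add: univ)
  have B_univ: "B \<in> universe M" using ends le by (auto simp: univ)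
  have ne: "universe M \<noteq> {}" using ends by auto
  have vk: "trm_vars a \<subseteq> {k..}" "trm_vars b \<subseteq> {k..}" "trm_vars c \<subseteq> {k..}"
    using Suc.prems(1-3) atLeast_subset_iff[of "Suc k" k] by (meson Suc_n_not_le_n le_SucI order_refl subset_trans)+
  have val_upd: "trm_val M (e(k := u)) a = A" "trm_val M (e(k := u)) b = B"
    "trm_val M (e(k := u)) c = C" for u
    using trm_val_agree[OF Suc.prems(1), of "e(k := u)" e M]
      trm_val_agree[OF Suc.prems(2), of "e(k := u)" e M]
      trm_val_agree[OF Suc.prems(3), of "e(k := u)" e M] by (auto simp: ABC)
  \<comment> \<open>The inner prefix binds only variables below \<open>k\<close>, so it changes
    neither the chosen point nor the three end points.\<close>
  have agree: "e' k = u \<and> trm_val M e' a = A \<and> trm_val M e' b = B \<and> trm_val M e' c = C"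
    if "\<forall>v. v \<notin> snd ` set (alternating q (rev [0..<k])) \<longrightarrow> e' v = (e(k := u)) v" for e' u q
  proof -
    have ag: "\<forall>v. v \<notin> {..<k} \<longrightarrow> e' v = (e(k := u)) v"
      using that by (auto simp: atLeast0LessThan)
    have "trm_val M e' t = trm_val M (e(k := u)) t" if "trm_vars t \<subseteq> {k..}" for t
      by (rule trm_val_agree[OF that ag])
    from this[OF vk(1)] this[OF vk(2)] this[OF vk(3)] show ?thesis
      using ag by (simp add: val_upd)
  qed
  let ?all = "alternating All_q (rev [0..<k])" and ?ex = "alternating Ex_q (rev [0..<k])"
  have IH_ab: "(even k \<longrightarrow> 3 * x \<le> 2 * 2 ^ k + 1 \<longrightarrow> 3 * y \<le> 2 * 2 ^ k + 1 \<longrightarrow>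
      (sat M (e(k := u)) (quantify ?all (both_ge k a (Var k) b x y)) \<longleftrightarrow> x \<le> u - A \<and> y \<le> B - u)) \<and>
    (odd k \<longrightarrow> 3 * x \<le> 2 * 2 ^ k + 2 \<longrightarrow> 3 * y \<le> 2 * 2 ^ k + 2 \<longrightarrow>
      (sat M (e(k := u)) (quantify ?ex (either_ge k a (Var k) b x y)) \<longleftrightarrow> x \<le> u - A \<or> y \<le> B - u))"
    if "A < u" "u \<le> B" for u x y
  proof -
    have "trm_vars (Var k) \<subseteq> {k..}" by simp
    note IH = Suc.IH[OF vk(1) this vk(2), where e = "e(k := u)" and d = x and d' = y, unfolded val_upd trm_val.simps fun_upd_same]
    show ?thesis by (rule IH) (use that ends B_univ in auto)
  qed
  have IH_bc: "(even k \<longrightarrow> 3 * x \<le> 2 * 2 ^ k + 1 \<longrightarrow> 3 * y \<le> 2 * 2 ^ k + 1 \<longrightarrow>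
      (sat M (e(k := u)) (quantify ?all (both_ge k b (Var k) c x y)) \<longleftrightarrow> x \<le> u - B \<and> y \<le> C - u)) \<and>
    (odd k \<longrightarrow> 3 * x \<le> 2 * 2 ^ k + 2 \<longrightarrow> 3 * y \<le> 2 * 2 ^ k + 2 \<longrightarrow>
      (sat M (e(k := u)) (quantify ?ex (either_ge k b (Var k) c x y)) \<longleftrightarrow> x \<le> u - B \<or> y \<le> C - u))"
    if "B < u" "u \<le> C" for u x y
  proof -
    have "trm_vars (Var k) \<subseteq> {k..}" by simp
    note IH = Suc.IH[OF vk(2) this vk(3), where e = "e(k := u)" and d = x and d' = y, unfolded val_upd trm_val.simps fun_upd_same]
    show ?thesis by (rule IH) (use that ends B_univ in auto)
  qed
  have step_all: "sat M e (quantify (alternating All_q (rev [0..<Suc k])) (both_ge (Suc k) a b c d d')) \<longleftrightarrow>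
      d \<le> B - A \<and> d' \<le> C - B" (is "?L \<longleftrightarrow> _")
    if "odd k" and d: "3 * d \<le> 2 * 2 ^ Suc k + 1" "3 * d' \<le> 2 * 2 ^ Suc k + 1"
  proof -
    have "(2::nat) ^ k mod 3 = 2" using that by (simp add: power_2_mod_3)
    with d have bounds: "3 * (d div 2 + 1) \<le> 2 * 2 ^ k + 2" "3 * ((d + 1) div 2) \<le> 2 * 2 ^ k + 2"
      "3 * (d' div 2 + 1) \<le> 2 * 2 ^ k + 2" "3 * ((d' + 1) div 2) \<le> 2 * 2 ^ k + 2"
      unfolding power_Suc using halving_bounds(1)[of "2 ^ k"] by blast+
    have IH1: "sat M (e(k := u)) (quantify ?ex (either_ge k a (Var k) b (d div 2 + 1) ((d + 1) div 2)))
        \<longleftrightarrow> d div 2 + 1 \<le> u - A \<or> (d + 1) div 2 \<le> B - u" if "A < u" "u \<le> B" for u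
      using IH_ab[OF that, of "d div 2 + 1" "(d + 1) div 2"] bounds \<open>odd k\<close> by blast
    have IH2: "sat M (e(k := u)) (quantify ?ex (either_ge k b (Var k) c (d' div 2 + 1) ((d' + 1) div 2)))
        \<longleftrightarrow> d' div 2 + 1 \<le> u - B \<or> (d' + 1) div 2 \<le> C - u" if "B < u" "u \<le> C" for u
      using IH_bc[OF that, of "d' div 2 + 1" "(d' + 1) div 2"] bounds \<open>odd k\<close> by blast
    let ?g = "(d > 0 \<longrightarrow> A < B) \<and> (d' > 0 \<longrightarrow> B < C)"
    have body: "sat M (e(k := u)) (quantify ?ex (both_ge (Suc k) a b c d d')) \<longleftrightarrow>
        ?g \<and> (A < u \<and> u \<le> B \<longrightarrow> d div 2 + 1 \<le> u - A \<or> (d + 1) div 2 \<le> B - u) \<and>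
        (B < u \<and> u \<le> C \<longrightarrow> d' div 2 + 1 \<le> u - B \<or> (d' + 1) div 2 \<le> C - u)" (is "?l \<longleftrightarrow> ?r") for u
    proof -
      \<comment> \<open>As \<open>u\<close> lies in at most one of the two intervals, the matrix
        collapses under the inner prefix to a constant or to a single recursive formula.\<close>
      consider "\<not> ?g" | "?g" "A < u" "u \<le> B" "\<not> B < u" | "?g" "B < u" "u \<le> C" "\<not> u \<le> B"
        | "?g" "\<not> (A < u \<and> u \<le> B)" "\<not> (B < u \<and> u \<le> C)"
        by linarith
      then show ?thesis
      proof cases
        case 1
        have "?l = False"
          by (rule sat_quantify_const[OF ne], drule agree) (use 1 in auto)
        then show ?thesis using 1 by blast
      next
        case 2
        have "?l = sat M (e(k := u)) (quantify ?ex (either_ge k a (Var k) b (d div 2 + 1) ((d + 1) div 2)))"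
          by (rule sat_quantify_cong, drule agree) (use 2 in simp)
        then show ?thesis using 2 IH1[OF 2(2,3)] by blast
      next
        case 3
        have "?l = sat M (e(k := u)) (quantify ?ex (either_ge k b (Var k) c (d' div 2 + 1) ((d' + 1) div 2)))"
          by (rule sat_quantify_cong, drule agree) (use 3 in simp)
        then show ?thesis using 3 IH2[OF 3(2,3)] by blast
      next
        case 4
        have "?l = True"
          by (rule sat_quantify_const[OF ne], drule agree) (use 4 in auto)
        then show ?thesis using 4 by blast
      qed
    qed
    have "?L \<longleftrightarrow> (\<forall>u\<in>universe M. sat M (e(k := u)) (quantify ?ex (both_ge (Suc k) a b c d d')))"
      by (simp del: both_ge.simps)
    also have "\<dots> \<longleftrightarrow> d \<le> B - A \<and> d' \<le> C - B"
      \<comment> \<open>Both intervals lie inside the universe, so the bounded quantifier reaches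
        all their points; nonemptiness extracts the guard, which does not depend on
        \<open>u\<close>.\<close>
      unfolding body split_all[OF le(1)] split_all[OF le(2)]
      using inside ne by blast
    finally show ?thesis .
  qed
  have step_ex: "sat M e (quantify (alternating Ex_q (rev [0..<Suc k])) (either_ge (Suc k) a b c d d')) \<longleftrightarrow>
      d \<le> B - A \<or> d' \<le> C - B" (is "?L \<longleftrightarrow> _")
    if "even k" and d: "3 * d \<le> 2 * 2 ^ Suc k + 2" "3 * d' \<le> 2 * 2 ^ Suc k + 2"
  proof (cases "d = 0 \<or> d' = 0")
    \<comment> \<open>A zero threshold is treated apart: its interval may be empty and then offers
      no witness for the trivially true disjunct.\<close>
    case True
    have "?L = True"
      by (rule sat_quantify_const[OF ne]) (use True in auto)
    then show ?thesis using True by auto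
  next
    case False
    have "(2::nat) ^ k mod 3 = 1" using that by (simp add: power_2_mod_3)
    with d have bounds: "3 * ((d + 1) div 2) \<le> 2 * 2 ^ k + 1" "3 * (d div 2) \<le> 2 * 2 ^ k + 1"
      "3 * ((d' + 1) div 2) \<le> 2 * 2 ^ k + 1" "3 * (d' div 2) \<le> 2 * 2 ^ k + 1"
      unfolding power_Suc using halving_bounds(2)[of "2 ^ k"] by blast+
    have IH1: "sat M (e(k := u)) (quantify ?all (both_ge k a (Var k) b ((d + 1) div 2) (d div 2)))
        \<longleftrightarrow> (d + 1) div 2 \<le> u - A \<and> d div 2 \<le> B - u" if "A < u" "u \<le> B" for u
      using IH_ab[OF that, of "(d + 1) div 2" "d div 2"] bounds \<open>even k\<close> by blast
    have IH2: "sat M (e(k := u)) (quantify ?all (both_ge k b (Var k) c ((d' + 1) div 2) (d' div 2)))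
        \<longleftrightarrow> (d' + 1) div 2 \<le> u - B \<and> d' div 2 \<le> C - u" if "B < u" "u \<le> C" for u
      using IH_bc[OF that, of "(d' + 1) div 2" "d' div 2"] bounds \<open>even k\<close> by blast
    have body: "sat M (e(k := u)) (quantify ?all (either_ge (Suc k) a b c d d')) \<longleftrightarrow>
        (A < u \<and> u \<le> B \<and> (d + 1) div 2 \<le> u - A \<and> d div 2 \<le> B - u) \<or>
        (B < u \<and> u \<le> C \<and> (d' + 1) div 2 \<le> u - B \<and> d' div 2 \<le> C - u)" (is "?l \<longleftrightarrow> ?r") for u
    proof -
      consider "A < u" "u \<le> B" "\<not> B < u" | "B < u" "u \<le> C" "\<not> u \<le> B"
        | "\<not> (A < u \<and> u \<le> B)" "\<not> (B < u \<and> u \<le> C)"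
        by linarith
      then show ?thesis
      proof cases
        case 1
        have "?l = sat M (e(k := u)) (quantify ?all (both_ge k a (Var k) b ((d + 1) div 2) (d div 2)))"
          by (rule sat_quantify_cong, drule agree) (use 1 False in simp)
        then show ?thesis using 1 IH1[OF 1(1,2)] by blast
      next
        case 2
        have "?l = sat M (e(k := u)) (quantify ?all (both_ge k b (Var k) c ((d' + 1) div 2) (d' div 2)))"
          by (rule sat_quantify_cong, drule agree) (use 2 False in simp)
        then show ?thesis using 2 IH2[OF 2(1,2)] by blast
      next
        case 3
        have "?l = False"
          by (rule sat_quantify_const[OF ne], drule agree) (use 3 False in auto)
        then show ?thesis using 3 by blast
      qed
    qed
    have pos: "d > 0" "d' > 0" using False by auto
    have "?L \<longleftrightarrow> (\<exists>u\<in>universe M. sat M (e(k := u)) (quantify ?all (either_ge (Suc k) a b c d d')))"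
      by (simp del: either_ge.simps)
    also have "\<dots> \<longleftrightarrow> d \<le> B - A \<or> d' \<le> C - B"
      unfolding body split_ex[OF le(1) pos(1)] split_ex[OF le(2) pos(2)]
      using inside by blast
    finally show ?thesis .
  qed
  show ?case using step_all step_ex unfolding ABC by (simp only: even_Suc) blast
qed

section \<open>Codes\<close>

definition Big_conj :: "fm list \<Rightarrow> fm" where
  "Big_conj \<phi>s = foldr Conj \<phi>s Tt"

definition Big_disj :: "fm list \<Rightarrow> fm" where
  "Big_disj \<phi>s = foldr Disj \<phi>s (Neg Tt)"

lemma Big_conj_simps:
  "sat M e (Big_conj \<phi>s) \<longleftrightarrow> (\<forall>\<phi>\<in>set \<phi>s. sat M e \<phi>)"
  "free_vars (Big_conj \<phi>s) = (\<Union>\<phi>\<in>set \<phi>s. free_vars \<phi>)"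
  "num_quants (Big_conj \<phi>s) = sum_list (map num_quants \<phi>s)"
  by (induction \<phi>s) (auto simp: Big_conj_def)

lemma Big_disj_simps:
  "sat M e (Big_disj \<phi>s) \<longleftrightarrow> (\<exists>\<phi>\<in>set \<phi>s. sat M e \<phi>)"
  "free_vars (Big_disj \<phi>s) = (\<Union>\<phi>\<in>set \<phi>s. free_vars \<phi>)"
  "num_quants (Big_disj \<phi>s) = sum_list (map num_quants \<phi>s)"
  by (induction \<phi>s) (auto simp: Big_disj_def)

text \<open>With the variables \<open>s, \<dots>, s + m - 1\<close> denoting \<open>m\<close> marks, the variables
  \<open>s + m, \<dots>, s + 2 * m - 1\<close> spell out the word \<open>c\<close> of length \<open>m\<close> over the alphabet of marks.\<close>

definition Code :: "nat \<Rightarrow> nat \<Rightarrow> (nat \<Rightarrow> nat) \<Rightarrow> fm" where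
  "Code s m c = Big_conj
     [if a = c b then Eq (Var (s + m + b)) (Var (s + a)) else Neg (Eq (Var (s + m + b)) (Var (s + a))).
      b \<leftarrow> [0..<m], a \<leftarrow> [0..<m]]"

lemma sat_Code:
  "sat M e (Code s m c) \<longleftrightarrow> (\<forall>a<m. \<forall>b<m. a = c b \<longleftrightarrow> e (s + m + b) = e (s + a))"
  by (simp add: Code_def Big_conj_simps del: if_image_distrib split: if_split)
    (metis atLeastLessThan_iff le0)

lemma free_vars_Code: "free_vars (Code s m c) \<subseteq> {s..<s + 2 * m}"
  by (auto simp: Code_def Big_conj_simps split: if_splits)

lemma num_quants_Code: "num_quants (Code s m c) = 0"
  by (auto simp: Code_def Big_conj_simps sum_list_eq_0_iff split: if_splits)

text \<open>\<open>Code s m c\<close> makes the mark \<open>c b\<close> the only one equal to the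
  letter at \<open>b\<close>, because all other marks are required to differ from that
  letter.\<close>

lemma Code_unique:
  assumes "c \<in> {..<m} \<rightarrow>\<^sub>E {..<m}" "c' \<in> {..<m} \<rightarrow>\<^sub>E {..<m}"
    and "sat M e (Code s m c)" "sat M e (Code s m c')"
  shows "c = c'"
proof (rule PiE_ext[OF assms(1,2)])
  fix b assume "b \<in> {..<m}"
  moreover have "c b < m" using assms(1) calculation by auto
  ultimately show "c b = c' b" using assms(3,4) by (auto simp: sat_Code)
qed

lemma ex_codes:
  assumes "n \<le> m ^ m"
  obtains c :: "nat \<Rightarrow> nat \<Rightarrow> nat"
  where "inj_on c {..<n}" "\<And>i. i < n \<Longrightarrow> c i \<in> {..<m} \<rightarrow>\<^sub>E {..<m}"
proof -
  have "card {..<n} \<le> card ({..<m} \<rightarrow>\<^sub>E {..<m})"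
    using assms by (simp add: card_funcsetE)
  then obtain c where "c ` {..<n} \<subseteq> {..<m} \<rightarrow>\<^sub>E {..<m}" "inj_on c {..<n}"
    using card_le_inj[of "{..<n}" "{..<m} \<rightarrow>\<^sub>E {..<m}"] by (auto simp: finite_PiE)
  then show thesis using that by blast
qed

section \<open>The sentence\<close>

text \<open>Variable \<open>K\<close> is the universally chosen position, and the variables below \<open>K\<close> measure its
  distances to both ends. Variable \<open>K + 1\<close> is reserved for dummy quantifiers.\<close>

definition One_vs_all_matrix :: "nat \<Rightarrow> nat \<Rightarrow> (nat \<Rightarrow> nat \<Rightarrow> nat) \<Rightarrow> bool list \<Rightarrow> fm" where
  "One_vs_all_matrix K m c w = Big_disj
     [Conj (Code (K + 2) m (c i))
        (Conj (if w ! i then InS (Var K) else Neg (InS (Var K)))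
          (both_ge K MinC (Var K) MaxC i (length w - 1 - i))). i \<leftarrow> [0..<length w]]"

lemma num_quants_One_vs_all_matrix: "num_quants (One_vs_all_matrix K m c w) = 0"
  by (auto simp: One_vs_all_matrix_def Big_disj_simps sum_list_eq_0_iff num_quants_Code)

lemma free_vars_One_vs_all_matrix: "free_vars (One_vs_all_matrix K m c w) \<subseteq> {..K} \<union> {K + 2..<K + 2 + 2 * m}"
proof -
  have "free_vars (both_ge K MinC (Var K) MaxC d d') \<subseteq> {..K}" for d d'
    using free_vars_ge(1)[of K MinC "Var K" MaxC d d'] by auto
  moreover have "free_vars (if w ! i then InS (Var K) else Neg (InS (Var K))) \<subseteq> {..K}" for i
    by auto
  ultimately show ?thesis
    using free_vars_Code[of "K + 2" m]
    unfolding One_vs_all_matrix_def Big_disj_simps by (fastforce simp del: atMost_iff)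
qed

text \<open>The code is fixed outside the prefix and leaves at most one live disjunct, so the prefix
  only has to evaluate a single \<open>both_ge\<close> formula. This is how all positions share the
  same quantifiers.\<close>

lemma sat_One_vs_all_matrix:
  assumes n: "length w = n" "n \<ge> 1" "length w' = n"
    and K: "even K" "3 * n \<le> 2 * 2 ^ K + 1"
    and c: "inj_on c {..<n}" "\<And>i. i < n \<Longrightarrow> c i \<in> {..<m} \<rightarrow>\<^sub>E {..<m}"
    and j: "j < n" "e K = j + 1"
  shows "sat (string_struct w') e (quantify (alternating All_q (rev [0..<K])) (One_vs_all_matrix K m c w))
    \<longleftrightarrow> w' ! j = w ! j \<and> sat (string_struct w') e (Code (K + 2) m (c j))"
    (is "sat ?M e (quantify ?ps _) \<longleftrightarrow> _")
proof -
  have ne: "universe ?M \<noteq> {}" using n by (auto simp: string_struct_def)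
  have agree: "e' K = e K \<and> (\<forall>d. sat ?M e' (Code (K + 2) m d) = sat ?M e (Code (K + 2) m d))"
    if "\<forall>v. v \<notin> snd ` set ?ps \<longrightarrow> e' v = e v" for e'
    using that by (auto simp: sat_Code)
  have S: "sat ?M e' (if w ! i then InS (Var K) else Neg (InS (Var K))) \<longleftrightarrow> w' ! j = w ! i"
    if "e' K = e K" for e' i
    using that j n by (auto simp: string_struct_def)
  \<comment> \<open>The thresholds \<open>i\<close> and \<open>n - 1 - i\<close> add up to the
    distance between the ends, so both lower bounds hold only for \<open>i = j\<close>.\<close>
  have ge: "sat ?M e (quantify ?ps (both_ge K MinC (Var K) MaxC i (n - 1 - i))) \<longleftrightarrow> i = j"
    if "i < n" for i
    using sat_ge[of MinC K "Var K" MaxC w' e i "n - 1 - i"] that K n j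
    by (auto simp: string_struct_def)
  show ?thesis
  proof (cases "\<exists>i<n. sat ?M e (Code (K + 2) m (c i))")
    case False
    have "sat ?M e (quantify ?ps (One_vs_all_matrix K m c w)) = False"
      by (rule sat_quantify_const[OF ne], drule agree)
        (use False n in \<open>auto simp: One_vs_all_matrix_def Big_disj_simps\<close>)
    then show ?thesis using False j by blast
  next
    case True
    then obtain i where i: "i < n" "sat ?M e (Code (K + 2) m (c i))" by blast
    have uniq: "sat ?M e (Code (K + 2) m (c l)) \<longleftrightarrow> l = i" if "l < n" for l
      using Code_unique[OF c(2)[OF that] c(2)[OF i(1)], of ?M e "K + 2"] i that c(1)
      by (auto dest: inj_onD)
    show ?thesis
    proof (cases "w' ! j = w ! i")
      case True
      have "sat ?M e (quantify ?ps (One_vs_all_matrix K m c w)) =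
          sat ?M e (quantify ?ps (both_ge K MinC (Var K) MaxC i (n - 1 - i)))"
        by (rule sat_quantify_cong, drule agree)
          (use True uniq n i S in \<open>auto simp: One_vs_all_matrix_def Big_disj_simps simp del: sat.simps(3)\<close>)
      then show ?thesis using ge[OF i(1)] uniq[OF j(1)] True by auto
    next
      case False
      have "sat ?M e (quantify ?ps (One_vs_all_matrix K m c w)) = False"
        by (rule sat_quantify_const[OF ne], drule agree)
          (use False uniq n i S in \<open>auto simp: One_vs_all_matrix_def Big_disj_simps simp del: sat.simps(3)\<close>)
      then show ?thesis using False uniq[OF j(1)] by auto
    qed
  qed
qed

text \<open>Only the variables bound by each kind of quantifier in \<open>ps\<close> are prescribed,
  which admits both a purely existential block and one padded with dummy universal
  quantifiers.\<close>

lemma one_vs_all_sentence: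
  assumes n: "length w = n" "n \<ge> 1"
    and m: "m \<le> n" "n \<le> m ^ m"
    and K: "even K" "3 * n \<le> 2 * 2 ^ K + 1"
    and ps: "\<And>v. (Ex_q, v) \<in> set ps \<longleftrightarrow> v \<in> {K + 2..<K + 2 + 2 * m}"
      "\<And>v. (All_q, v) \<in> set ps \<Longrightarrow> v = K + 1"
  obtains \<phi> where "sentence \<phi>" "true_in (string_struct w) \<phi>"
    "\<And>w'. length w' = n \<Longrightarrow> w' \<noteq> w \<Longrightarrow> \<not> true_in (string_struct w') \<phi>"
    "num_quants \<phi> = 1 + length ps + K"
    "prenex (All_q # map fst ps @ map fst (alternating All_q (rev [0..<K]))) \<phi>"
proof -
  obtain c :: "nat \<Rightarrow> nat \<Rightarrow> nat"
    where c: "inj_on c {..<n}" "\<And>i. i < n \<Longrightarrow> c i \<in> {..<m} \<rightarrow>\<^sub>E {..<m}"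
    using ex_codes[OF m(2)] by blast
  let ?alt = "alternating All_q (rev [0..<K])" and ?mat = "One_vs_all_matrix K m c w"
  define \<phi> where "\<phi> = quantify ((All_q, K) # ps @ ?alt) ?mat"
  have \<phi>: "\<phi> = Forall K (quantify ps (quantify ?alt ?mat))"
    by (simp add: \<phi>_def quantify_append)
  have vars: "snd ` set ps \<subseteq> {K + 1..}" "{K + 2..<K + 2 + 2 * m} \<subseteq> snd ` set ps"
  proof -
    have "v \<ge> K + 1" if "(q, v) \<in> set ps" for q v
      using that ps[of v] by (cases q) auto
    then show "snd ` set ps \<subseteq> {K + 1..}" by auto
    show "{K + 2..<K + 2 + 2 * m} \<subseteq> snd ` set ps"
      using ps(1) by (force simp: image_iff)
  qed
  have "sentence \<phi>"
  proof -
    have "{..K} = insert K {..<K}" by auto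
    then show ?thesis
      using free_vars_One_vs_all_matrix[of K m c w] vars(2)
      by (auto simp: sentence_def \<phi>_def free_vars_quantify image_Un atLeast0LessThan)
  qed
  moreover have "true_in (string_struct w) \<phi>"
    unfolding true_in_def \<phi> sat.simps
  proof (intro allI impI ballI)
    fix e a
    assume "a \<in> universe (string_struct w)"
    then obtain j where j: "a = j + 1" "j < n"
      using n by (auto simp: string_struct_def intro: that[of "a - 1"])
    \<comment> \<open>Mark \<open>x\<close> is placed on position \<open>x + 1\<close>, which exists
      as \<open>m \<le> n\<close>, and letter \<open>b\<close> on the mark \<open>c j b\<close>;
      elsewhere 1 is a default.\<close>
    define f where "f v = (if v < K + 2 then 1 else if v < K + 2 + m then v - (K + 1)
      else if v < K + 2 + 2 * m then c j (v - (K + 2 + m)) + 1 else 1)" for v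
    have cj: "c j b < m" if "b < m" for b
      using c(2)[OF j(2)] that by auto
    show "sat (string_struct w) (e(K := a)) (quantify ps (quantify ?alt ?mat))"
    proof (rule sat_quantify_witness[where f = f])
      show "(Ex_q, v) \<notin> set ps" if "(All_q, v) \<in> set ps" for v
        using ps that by force
      show "f v \<in> universe (string_struct w)" for v
        using cj[of "v - (K + 2 + m)"] m n by (fastforce simp: f_def string_struct_def)
      fix e'
      assume e': "\<forall>v. (Ex_q, v) \<in> set ps \<longrightarrow> e' v = f v"
        "\<forall>v. v \<notin> snd ` set ps \<longrightarrow> e' v = (e(K := a)) v"
      have "K \<notin> snd ` set ps" using vars(1) by auto
      then have "e' K = j + 1" using e'(2) j by simp
      moreover have "e' (K + 2 + x) = x + 1" "e' (K + 2 + m + x) = c j x + 1" if "x < m" for x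
        using e'(1) that by (auto simp: ps(1) f_def)
      then have "sat (string_struct w) e' (Code (K + 2) m (c j))"
        by (auto simp: sat_Code)
      ultimately show "sat (string_struct w) e' (quantify ?alt ?mat)"
        using sat_One_vs_all_matrix[OF n n(1) K c j(2), of e'] by simp
    qed
  qed
  moreover have "\<not> true_in (string_struct w') \<phi>" if w': "length w' = n" "w' \<noteq> w" for w'
  proof
    assume true: "true_in (string_struct w') \<phi>"
    obtain j where j: "j < n" "w' ! j \<noteq> w ! j"
      using w' n by (auto simp: list_eq_iff_nth_eq)
    have ne: "universe (string_struct w') \<noteq> {}" using n w' by (auto simp: string_struct_def)
    have "sat (string_struct w') (\<lambda>_. 1) \<phi>"
      using true n w' by (auto simp: true_in_def string_struct_def)
    then have "sat (string_struct w') ((\<lambda>_. 1)(K := j + 1)) (quantify ps (quantify ?alt ?mat))"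
      using j w' by (auto simp: \<phi> string_struct_def)
    \<comment> \<open>Whatever code this assignment spells out, the matrix forces
      \<open>w' ! j = w ! j\<close>.\<close>
    then obtain e where e: "\<forall>v. v \<notin> snd ` set ps \<longrightarrow> e v = ((\<lambda>_. 1)(K := j + 1)) v"
      and sat: "sat (string_struct w') e (quantify ?alt ?mat)"
      using sat_quantify_obtain[OF ne] by blast
    have "K \<notin> snd ` set ps" using vars(1) by auto
    then have "e K = j + 1" using e by simp
    then show False
      using sat_One_vs_all_matrix[OF n w'(1) K c j(1)] sat j(2) by blast
  qed
  moreover have "num_quants \<phi> = 1 + length ps + K"
    by (simp add: \<phi>_def num_quants_quantify num_quants_One_vs_all_matrix)
  moreover have "prenex (All_q # map fst ps @ map fst ?alt) \<phi>"
    using prenex_quantify[OF num_quants_One_vs_all_matrix, of "(All_q, K) # ps @ ?alt"]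
    by (simp add: \<phi>_def)
  ultimately show thesis using that by blast
qed

section \<open>The choice of parameters\<close>

lemma ex_measuring_length:
  assumes "n \<ge> 1"
  obtains K where "even K" "3 * n \<le> 2 * 2 ^ K + 1" "real K \<le> log 2 (real n) + 4"
proof -
  define c where "c = nat \<lceil>log 2 (real n) / 2\<rceil>"
  have "log 2 (real n) \<ge> 0" using assms by simp
  then have c: "log 2 (real n) \<le> real (2 * c)" "real (2 * c) \<le> log 2 (real n) + 2"
    unfolding c_def by linarith+
  have "real n = 2 powr log 2 (real n)" using assms by simp
  also have "\<dots> \<le> 2 powr real (2 * c)" using c(1) by (intro powr_mono) auto
  also have "\<dots> = real (2 ^ (2 * c))" by (subst powr_realpow) auto
  finally have "n \<le> 2 ^ (2 * c)" by (simp only: of_nat_le_iff)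
  \<comment> \<open>Adding 2 keeps the exponent even and gives \<open>8 * 2 ^ (2 * c)\<close>,
    enough for \<open>3 * n\<close>.\<close>
  then have "3 * n \<le> 2 * 2 ^ (2 * c + 2) + 1" by (simp add: power_add)
  then show thesis using c by (intro that[of "2 * c + 2"]) auto
qed

text \<open>For \<open>m\<close> about \<open>\<epsilon> / 2 * log n\<close>, the logarithm of
  \<open>m ^ m\<close> has order \<open>log n * log (log n)\<close> and eventually exceeds that of
  \<open>n\<close>.\<close>

lemma ex_code_length:
  fixes \<epsilon> :: real
  assumes "\<epsilon> > 0"
  obtains N where "\<And>n. n \<ge> N \<Longrightarrow> \<exists>m\<le>n. n \<le> m ^ m \<and> 2 * real m \<le> \<epsilon> * log 2 (real n)"
proof -
  define L where "L n = \<epsilon> / 2 * log 2 (real n)" for n :: nat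
  have "\<forall>\<^sub>F n in sequentially. L n \<le> real n"
    unfolding L_def using assms by real_asymp
  moreover have "\<forall>\<^sub>F n in sequentially. L n \<ge> 2"
    unfolding L_def using assms by real_asymp
  \<comment> \<open>\<open>L n - 1\<close> bounds the integer part of \<open>L n\<close> from below,
    and \<open>L n \<ge> 2\<close> keeps \<open>ln (L n - 1)\<close> nonnegative.\<close>
  moreover have "\<forall>\<^sub>F n in sequentially. ln (real n) \<le> (L n - 1) * ln (L n - 1)"
    unfolding L_def using assms by real_asymp
  ultimately have "\<forall>\<^sub>F n in sequentially.
    n \<ge> 1 \<and> L n \<le> real n \<and> L n \<ge> 2 \<and> ln (real n) \<le> (L n - 1) * ln (L n - 1)"
    using eventually_ge_at_top[of 1] by eventually_elim auto
  then obtain N where N: "\<And>n. n \<ge> N \<Longrightarrow>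
    n \<ge> 1 \<and> L n \<le> real n \<and> L n \<ge> 2 \<and> ln (real n) \<le> (L n - 1) * ln (L n - 1)"
    unfolding eventually_sequentially by blast
  have "\<exists>m\<le>n. n \<le> m ^ m \<and> 2 * real m \<le> \<epsilon> * log 2 (real n)" if "n \<ge> N" for n
  proof (intro exI conjI)
    let ?m = "nat \<lfloor>L n\<rfloor>"
    note n = N[OF that]
    have m: "real ?m \<le> L n" "L n - 1 \<le> real ?m" "?m \<ge> 1" using n by linarith+
    show "?m \<le> n" using m n by linarith
    show "2 * real ?m \<le> \<epsilon> * log 2 (real n)" using m unfolding L_def by linarith
    have "ln (real n) \<le> (L n - 1) * ln (L n - 1)" using n by blast
    also have "\<dots> \<le> real ?m * ln (real ?m)"
      using m n by (intro mult_mono) auto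
    also have "\<dots> = ln (real (?m ^ ?m))" using m by (simp add: ln_realpow)
    finally show "n \<le> ?m ^ ?m"
      using m n by (subst (asm) ln_le_cancel_iff) (auto simp flip: of_nat_power)
  qed
  then show thesis using that by blast
qed

text \<open>Each padded pair ends in \<exists>, so the next pair or the measuring prefix can start
  with \<forall>.\<close>

lemma alternating_pad:
  "concat (map (\<lambda>v. [(All_q, d), (Ex_q, v)]) vs) @ alternating All_q us =
     alternating All_q (concat (map (\<lambda>v. [d, v]) vs) @ us)"
  by (induction vs) auto

theorem theorem5p3:
  "\<forall>\<epsilon>::real. \<epsilon> > 0 \<longrightarrow>
     (\<exists>C::real. \<forall>n::nat. n \<ge> 1 \<longrightarrow>
       (\<forall>w::bool list. length w = n \<longrightarrow>
         (\<exists>\<phi>::fm.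
            sentence \<phi> \<and>
            true_in (string_struct w) \<phi> \<and>
            (\<forall>w'::bool list. length w' = n \<and> w' \<noteq> w \<longrightarrow> \<not> true_in (string_struct w') \<phi>) \<and>
            real (num_quants \<phi>) \<le> (1 + \<epsilon>) * log 2 (real n) + C \<and>
            (\<exists>(k::nat) (qs::quant list).
               prenex (All_q # replicate k Ex_q @ qs) \<phi> \<and>
               real k \<le> \<epsilon> * log 2 (real n) + 1 \<and>
               distinct_adj qs \<and>
               real (length qs) \<le> log 2 (real n) + C))))"
  (is "\<forall>\<epsilon>. _ \<longrightarrow> (\<exists>C. \<forall>n. _ \<longrightarrow> (\<forall>w. _ \<longrightarrow> ?P \<epsilon> C n w))")
proof (intro allI impI)
  fix \<epsilon> :: real
  assume "\<epsilon> > 0"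
  obtain N where N: "\<And>n. n \<ge> N \<Longrightarrow> \<exists>m\<le>n. n \<le> m ^ m \<and> 2 * real m \<le> \<epsilon> * log 2 (real n)"
    using ex_code_length[OF \<open>\<epsilon> > 0\<close>] by blast
  show "\<exists>C. \<forall>n. n \<ge> 1 \<longrightarrow> (\<forall>w. length w = n \<longrightarrow> ?P \<epsilon> C n w)"
  \<comment> \<open>In the constant, \<open>4 * N\<close> pays for the padded block when
    \<open>n < N\<close>, 4 for the excess of \<open>K\<close> over \<open>log n\<close>, and 1 for
    the leading \<forall>.\<close>
  proof (intro exI[of _ "4 * real N + 5"] allI impI)
    fix n :: nat and w :: "bool list"
    assume n: "n \<ge> 1" and w: "length w = n"
    obtain K where K: "even K" "3 * n \<le> 2 * 2 ^ K + 1" "real K \<le> log 2 (real n) + 4"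
      using ex_measuring_length[OF n] by blast
    have log: "\<epsilon> * log 2 (real n) \<ge> 0" using n \<open>\<epsilon> > 0\<close> by simp
    let ?alt = "alternating All_q (rev [0..<K])"
    show "?P \<epsilon> (4 * real N + 5) n w"
    proof (cases "n \<ge> N")
      case True
      then obtain m where m: "m \<le> n" "n \<le> m ^ m" "2 * real m \<le> \<epsilon> * log 2 (real n)"
        using N by blast
      define ps where "ps = map (Pair Ex_q) [K + 2..<K + 2 + 2 * m]"
      have fst_ps: "map fst ps = replicate (2 * m) Ex_q" "length ps = 2 * m"
        by (auto simp: ps_def comp_def map_replicate_const)
      obtain \<phi> where \<phi>: "sentence \<phi>" "true_in (string_struct w) \<phi>"
        "\<And>w'. length w' = n \<Longrightarrow> w' \<noteq> w \<Longrightarrow> \<not> true_in (string_struct w') \<phi>"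
        "num_quants \<phi> = 1 + length ps + K"
        "prenex (All_q # map fst ps @ map fst ?alt) \<phi>"
        by (rule one_vs_all_sentence[OF w n m(1,2) K(1,2), of ps]) (auto simp: ps_def)
      show "?P \<epsilon> (4 * real N + 5) n w"
      proof (intro exI[of _ \<phi>] exI[of _ "2 * m"] exI[of _ "map fst ?alt"] conjI)
        show "real (num_quants \<phi>) \<le> (1 + \<epsilon>) * log 2 (real n) + (4 * real N + 5)"
          using m(3) K(3) by (simp add: \<phi>(4) fst_ps algebra_simps)
      qed (use \<phi> fst_ps m K(3) in \<open>auto simp: distinct_adj_alternating\<close>)
    next
      case False
      \<comment> \<open>Here \<open>n\<close> marks suffice because \<open>n \<le> n ^ n\<close>,
        and the resulting \<open>4 * n\<close> quantifiers are bounded by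
        \<open>4 * N\<close>.\<close>
      define ps where "ps = concat (map (\<lambda>v. [(All_q, K + 1), (Ex_q, v)]) [K + 2..<K + 2 + 2 * n])"
      have ps: "length ps = 4 * n"
        by (auto simp: ps_def length_concat comp_def sum_list_triv)
      have "n \<le> n ^ n" using n by (simp add: self_le_power)
      then obtain \<phi> where \<phi>: "sentence \<phi>" "true_in (string_struct w) \<phi>"
        "\<And>w'. length w' = n \<Longrightarrow> w' \<noteq> w \<Longrightarrow> \<not> true_in (string_struct w') \<phi>"
        "num_quants \<phi> = 1 + length ps + K"
        "prenex (All_q # map fst ps @ map fst ?alt) \<phi>"
        by (rule one_vs_all_sentence[OF w n order_refl _ K(1,2), of ps])
          (auto simp: ps_def simp del: upt_Suc split: if_splits)
      have adj: "distinct_adj (map fst ps @ map fst ?alt)"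
        unfolding map_append[symmetric] ps_def alternating_pad by (rule distinct_adj_alternating)
      show "?P \<epsilon> (4 * real N + 5) n w"
      proof (intro exI[of _ \<phi>] exI[of _ 0] exI[of _ "map fst ps @ map fst ?alt"] conjI)
        show "real (num_quants \<phi>) \<le> (1 + \<epsilon>) * log 2 (real n) + (4 * real N + 5)"
          using False K(3) log by (simp add: \<phi>(4) ps algebra_simps)
      qed (use \<phi> adj False K(3) log ps in auto)
    qed
  qed
qed

end
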